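(* Let $\mathbf s\in\overline{\mathcal A}^r_e$ and let $\mathcal H^{\boldsymbol\Lambda}_{\boldsymbol\beta}$ be a block of an Ariki–Koike algebra with multicharge $\mathbf s$. If the block moving vector of $\mathcal H^{\boldsymbol\Lambda}_{\boldsymbol\beta}$ is $(m_1,m_2,\dots,m_r)$, then $\sum_{i=1}^r m_i=w(\mathcal H^{\boldsymbol\Lambda}_{\boldsymbol\beta})$.
   Context: Fix $e\in\{2,3,\dots\}\cup\{\infty\}$ (the quantum characteristic of $q\ne1$), $I=\mathbb Z/e\mathbb Z$ ($=\mathbb Z$ if $e=\infty$), and $\overline{\mathcal A}^r_e=\{\mathbf s\in\mathbb Z^r:0\le s_j-s_i\le e\text{ for all }i<j\}$. **Blocks.** The Ariki–Koike algebra has parameters $q$ and $Q=(q^{s_1},\dots,q^{s_r})$. The node $(i,j,k)$ (row $i$, column $j$, component $k$) of an $r$-partition $\boldsymbol\lambda=(\boldsymbol\lambda^{(1)},\dots,\boldsymbol\lambda^{(r)})$ has residue $j-i+s_k\in I$; $c_i(\boldsymbol\lambda)$ is the number of nodes of residue $i$. By the Lyle–Mathas theorem, blocks $\mathcal H^{\boldsymbol\Lambda}_{\boldsymbol\beta}$, with $\boldsymbol\Lambda=\sum_k\boldsymbol\Lambda_{s_k}$, correspond to elements $\boldsymbol\beta$ of the form $\sum_ic_i(\boldsymbol\lambda)\boldsymbol\alpha_i$, and $(\boldsymbol\lambda,\mathbf s)\in\mathcal H^{\boldsymbol\Lambda}_{\boldsymbol\beta}$ means $\boldsymbol\beta=\sum_ic_i(\boldsymbol\lambda)\boldsymbol\alpha_i$.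 **Weight.** $w(\mathcal H^{\boldsymbol\Lambda}_{\boldsymbol\beta})=(\boldsymbol\Lambda,\boldsymbol\beta)-\tfrac12(\boldsymbol\beta,\boldsymbol\beta)$, where $(\boldsymbol\Lambda_i,\boldsymbol\alpha_j)=\delta_{ij}$, $(\boldsymbol\alpha_i,\boldsymbol\alpha_j)=a_{ij}$ with $a_{ii}=2$; if $e\ne2$, $a_{ij}=-1$ for $i=j\pm1$ and $0$ otherwise; if $e=2$, $a_{ij}=-2$ for $i\ne j$. **Abaci.** For a partition $\lambda$ (with infinitely many zero parts) and $s\in\mathbb Z$ let $L_s(\lambda)=\{\lambda_j-j+s:j\ge1\}$. The $r$-abacus $L_{\mathbf s}(\boldsymbol\lambda)$ has rows $1,\dots,r$; position $(i,y)$ (row $i$, column $y\in\mathbb Z$) carries a bead iff $y\in L_{s_i}(\boldsymbol\lambda^{(i)})$. **Elementary operations and core.** First kind: if $1\le x<r$, $(x,y)$ has a bead and $(x+1,y)$ is empty, move the bead to $(x+1,y)$. Second kind: if $e\ne\infty$, $(r,y)$ has a bead and $(1,y-e)$ is empty, move the bead to $(1,y-e)$. An abacus is complete if $L_{s_1}(\boldsymbol\lambda^{(1)})\subseteq\cdots\subseteq L_{s_r}(\boldsymbol\lambda^{(r)})\subseteq L_{s_1+e}(\boldsymbol\lambda^{(1)})$ (last inclusion dropped if $e=\infty$). The core of $(\boldsymbol\lambda,\mathbf s)$ is the pair whose abacus is complete and obtained from $L_{\mathbf s}(\boldsymbol\lambda)$ by elementary operations. **Block moving vector.** The moving vector from an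 abacus to another one obtained from it by elementary operations is $(m_1,\dots,m_r)$ with $m_i$ the number of operations moving a bead out of row $i$ (independent of the sequence of operations). The block moving vector of a block is the moving vector from $L_{\mathbf s}(\boldsymbol\lambda)$ to its core for any $(\boldsymbol\lambda,\mathbf s)$ in the block (independent of the choice). *)

theory Defs
  imports Complex_Main "HOL-Library.Extended_Nat"
begin

(* Throughout, e :: enat is the quantum characteristic.  The index set
   Z/eZ (or Z, if e is infinite) is represented inside int by canonical representatives:
   {0..<e} for finite e, and all of int for e = \<infinity>. *)

definition residue :: "enat \<Rightarrow> int \<Rightarrow> int" where
  "residue e a = (case e of enat n \<Rightarrow> a mod int n | \<infinity> \<Rightarrow> a)"

(* r-tuples are functions on nat, of which only the values at 1, ..., r matter. *)

definition alcove_closure :: "enat \<Rightarrow> nat \<Rightarrow> (nat \<Rightarrow> int) set" where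
  "alcove_closure e r =
     {s. \<forall>i j. 1 \<le> i \<and> i < j \<and> j \<le> r \<longrightarrow>
           0 \<le> s j - s i \<and> (\<forall>n. e = enat n \<longrightarrow> s j - s i \<le> int n)}"

(* A partition is the infinite sequence of its parts p 1 \<ge> p 2 \<ge> ...;
   the value p 0 is irrelevant. *)

type_synonym parts = "nat \<Rightarrow> nat"

definition partition :: "parts \<Rightarrow> bool" where
  "partition p \<longleftrightarrow> (\<forall>i j. 1 \<le> i \<and> i \<le> j \<longrightarrow> p j \<le> p i) \<and> finite {i. 1 \<le> i \<and> p i \<noteq> 0}"

definition multipartition :: "nat \<Rightarrow> (nat \<Rightarrow> parts) \<Rightarrow> bool" where
  "multipartition r lam \<longleftrightarrow> (\<forall>k\<in>{1..r}. partition (lam k))"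

definition nodes :: "nat \<Rightarrow> (nat \<Rightarrow> parts) \<Rightarrow> (nat \<times> nat \<times> nat) set" where
  "nodes r lam = {(i, j, k). 1 \<le> i \<and> 1 \<le> j \<and> j \<le> lam k i \<and> 1 \<le> k \<and> k \<le> r}"

definition node_residue :: "enat \<Rightarrow> (nat \<Rightarrow> int) \<Rightarrow> nat \<times> nat \<times> nat \<Rightarrow> int" where
  "node_residue e s = (\<lambda>(i, j, k). residue e (int j - int i + s k))"

(* Elements of the positive root lattice are represented by their coefficient functions on
   canonical representatives; content e r s lam is the sum of the c_i(lam) \<alpha>_i. *)

definition content :: "enat \<Rightarrow> nat \<Rightarrow> (nat \<Rightarrow> int) \<Rightarrow> (nat \<Rightarrow> parts) \<Rightarrow> int \<Rightarrow> nat" where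
  "content e r s lam i = card {x \<in> nodes r lam. node_residue e s x = i}"

(* Blocks of the Ariki-Koike algebra with parameters q and (q^(s 1), ..., q^(s r)) are
   labelled, following Lyle and Mathas, by the contents of r-partitions. *)

definition in_block ::
  "enat \<Rightarrow> nat \<Rightarrow> (nat \<Rightarrow> int) \<Rightarrow> (int \<Rightarrow> nat) \<Rightarrow> (nat \<Rightarrow> parts) \<Rightarrow> bool" where
  "in_block e r s \<beta> lam \<longleftrightarrow> multipartition r lam \<and> \<beta> = content e r s lam"

definition is_block :: "enat \<Rightarrow> nat \<Rightarrow> (nat \<Rightarrow> int) \<Rightarrow> (int \<Rightarrow> nat) \<Rightarrow> bool" where
  "is_block e r s \<beta> \<longleftrightarrow> (\<exists>lam. in_block e r s \<beta> lam)"

(* Coefficients of \<Lambda> = \<Lambda>_(s 1) + ... + \<Lambda>_(s r) in the fundamental weights. *)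

definition dominant_weight :: "enat \<Rightarrow> nat \<Rightarrow> (nat \<Rightarrow> int) \<Rightarrow> int \<Rightarrow> nat" where
  "dominant_weight e r s i = card {k \<in> {1..r}. residue e (s k) = i}"

definition cartan :: "enat \<Rightarrow> int \<Rightarrow> int \<Rightarrow> int" where
  "cartan e i j =
     (if i = j then 2
      else if e = 2 then - 2
      else if i = residue e (j + 1) \<or> i = residue e (j - 1) then - 1
      else 0)"

(* The bilinear form on coefficient functions; \<beta> has finite support whenever it labels
   a block, so these are finite sums also for e = \<infinity>. *)

definition weight_root_form :: "(int \<Rightarrow> nat) \<Rightarrow> (int \<Rightarrow> nat) \<Rightarrow> int" where
  "weight_root_form \<Lambda> \<beta> = (\<Sum>i | \<beta> i \<noteq> 0. int (\<Lambda> i) * int (\<beta> i))"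

definition root_form :: "enat \<Rightarrow> (int \<Rightarrow> nat) \<Rightarrow> (int \<Rightarrow> nat) \<Rightarrow> int" where
  "root_form e \<beta> \<gamma> =
     (\<Sum>i | \<beta> i \<noteq> 0. \<Sum>j | \<gamma> j \<noteq> 0. int (\<beta> i) * int (\<gamma> j) * cartan e i j)"

definition block_weight :: "enat \<Rightarrow> (int \<Rightarrow> nat) \<Rightarrow> (int \<Rightarrow> nat) \<Rightarrow> rat" where
  "block_weight e \<Lambda> \<beta> =
     of_int (weight_root_form \<Lambda> \<beta>) - 1 / 2 * of_int (root_form e \<beta> \<beta>)"

definition beads :: "int \<Rightarrow> parts \<Rightarrow> int set" where
  "beads c p = {int (p j) - int j + c | j. 1 \<le> j}"

(* An abacus is the set of positions (row, column) carrying a bead. *)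

type_synonym abacus = "(nat \<times> int) set"

definition abacus :: "nat \<Rightarrow> (nat \<Rightarrow> int) \<Rightarrow> (nat \<Rightarrow> parts) \<Rightarrow> abacus" where
  "abacus r s lam = {(i, y). 1 \<le> i \<and> i \<le> r \<and> y \<in> beads (s i) (lam i)}"

(* elementary_op e r x A B: an elementary operation turns A into B by moving a bead
   out of row x. *)

inductive elementary_op :: "enat \<Rightarrow> nat \<Rightarrow> nat \<Rightarrow> abacus \<Rightarrow> abacus \<Rightarrow> bool"
  for e :: enat and r :: nat where
  first_kind:
    "1 \<le> x \<Longrightarrow> x < r \<Longrightarrow> (x, y) \<in> A \<Longrightarrow> (x + 1, y) \<notin> A \<Longrightarrow>
     elementary_op e r x A (insert (x + 1, y) (A - {(x, y)}))"
| second_kind: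
    "e = enat n \<Longrightarrow> (r, y) \<in> A \<Longrightarrow> (1, y - int n) \<notin> A \<Longrightarrow>
     elementary_op e r r A (insert (1, y - int n) (A - {(r, y)}))"

(* The list argument records the rows out of which the successive operations move a bead. *)

inductive elementary_ops :: "enat \<Rightarrow> nat \<Rightarrow> nat list \<Rightarrow> abacus \<Rightarrow> abacus \<Rightarrow> bool"
  for e :: enat and r :: nat where
  no_op: "elementary_ops e r [] A A"
| one_more_op:
    "elementary_op e r x A B \<Longrightarrow> elementary_ops e r xs B C \<Longrightarrow> elementary_ops e r (x # xs) A C"

definition complete_pair :: "enat \<Rightarrow> nat \<Rightarrow> (nat \<Rightarrow> int) \<Rightarrow> (nat \<Rightarrow> parts) \<Rightarrow> bool" where
  "complete_pair e r s lam \<longleftrightarrow>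
     (\<forall>i. 1 \<le> i \<and> i < r \<longrightarrow> beads (s i) (lam i) \<subseteq> beads (s (i + 1)) (lam (i + 1))) \<and>
     (\<forall>n. e = enat n \<longrightarrow> beads (s r) (lam r) \<subseteq> beads (s 1 + int n) (lam 1))"

(* is_core e r lam s mu t: the pair (mu, t) is the core of (lam, s). *)

definition is_core ::
  "enat \<Rightarrow> nat \<Rightarrow> (nat \<Rightarrow> parts) \<Rightarrow> (nat \<Rightarrow> int) \<Rightarrow> (nat \<Rightarrow> parts) \<Rightarrow> (nat \<Rightarrow> int) \<Rightarrow> bool" where
  "is_core e r lam s mu t \<longleftrightarrow>
     multipartition r mu \<and> complete_pair e r t mu \<and>
     (\<exists>xs. elementary_ops e r xs (abacus r s lam) (abacus r t mu))"

definition is_moving_vector :: "enat \<Rightarrow> nat \<Rightarrow> abacus \<Rightarrow> abacus \<Rightarrow> (nat \<Rightarrow> nat) \<Rightarrow> bool" where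
  "is_moving_vector e r A B m \<longleftrightarrow>
     (\<exists>xs. elementary_ops e r xs A B \<and> (\<forall>i\<in>{1..r}. m i = count_list xs i))"

(* The moving vector depends neither on the sequence of operations nor on the chosen member
   of the block.  Here it is a relation, satisfied by m as soon as m arises from some member
   and some sequence; as a hypothesis this presupposes nothing about these independences. *)

definition is_block_moving_vector ::
  "enat \<Rightarrow> nat \<Rightarrow> (nat \<Rightarrow> int) \<Rightarrow> (int \<Rightarrow> nat) \<Rightarrow> (nat \<Rightarrow> nat) \<Rightarrow> bool" where
  "is_block_moving_vector e r s \<beta> m \<longleftrightarrow>
     (\<exists>lam mu t. in_block e r s \<beta> lam \<and> is_core e r lam s mu t \<and>
        is_moving_vector e r (abacus r s lam) (abacus r t mu) m)"

end

(* For finite e = n, cut all abaci at a column L = n * m below which every row is full, and give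
   a finite set S of beads the potential
     r * (sum over beads (k, y) of y div n) - 1/2 * (sum over runners of (number of beads)^2)
       - 1/2 * (sum over beads (k, y) of 2k - r - 1),
   doubled below to stay in the integers.
   Telescoping over the nodes of lambda shows that the weight of the block is the potential of
   the abacus of lambda minus that of the abacus of the empty multipartition.  The first two terms
   are kept by an operation of the first kind and drop by r under one of the second kind; the
   third makes every operation lower the potential by exactly 1.  On a complete abacus the
   potential depends only on the number of beads, because there the bead counts b_1, ..., b_r of
   the rows on a runner increase weakly and b_r <= b_1 + 1.  Both the core and, as s lies in the
   closed alcove, the empty multipartition are complete, so the weight is the number of operations.  For infinite e
   everything takes place in a bounded range of columns and a large finite n may be used. *)

theory Submission imports Defs begin

section \<open>The potential of an abacus\<close>

definition beads_above :: "int \<Rightarrow> abacus \<Rightarrow> abacus" where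
  "beads_above L A = {p \<in> A. L \<le> snd p}"

definition full_below :: "nat \<Rightarrow> int \<Rightarrow> abacus \<Rightarrow> bool" where
  "full_below r L A \<longleftrightarrow> {1..r} \<times> {..<L} \<subseteq> A"

text \<open>The abacus of the empty multipartition with multicharge \<open>s\<close>.\<close>

definition vacuum :: "nat \<Rightarrow> (nat \<Rightarrow> int) \<Rightarrow> abacus" where
  "vacuum r s = {(k, y). k \<in> {1..r} \<and> y < s k}"

definition runner_count :: "int \<Rightarrow> abacus \<Rightarrow> int \<Rightarrow> int" where
  "runner_count n S a = int (card {p \<in> S. snd p mod n = a mod n})"

text \<open>Twice the linear contribution of one bead. The constant \<open>r + 1\<close> centres the
  row term: \<open>- 2 k + r + 1\<close> sums to zero over \<open>k = 1..r\<close>.\<close>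

definition bead_potential :: "int \<Rightarrow> nat \<Rightarrow> nat \<times> int \<Rightarrow> int" where
  "bead_potential n r p = 2 * int r * (snd p div n) - 2 * int (fst p) + int r + 1"

definition potential :: "int \<Rightarrow> nat \<Rightarrow> abacus \<Rightarrow> int" where
  "potential n r S = (\<Sum>p\<in>S. bead_potential n r p) - (\<Sum>c\<in>{0..<n}. (runner_count n S c)\<^sup>2)"

lemma runner_count_sum:
  "finite S \<Longrightarrow> runner_count n S a = (\<Sum>p\<in>S. of_bool (snd p mod n = a mod n))"
  by (simp add: runner_count_def of_bool_def sum.If_cases Int_def)

lemma runner_count_mod [simp]: "runner_count n S (a mod n) = runner_count n S a"
  by (simp add: runner_count_def)

text \<open>Grouping the beads of \<open>A\<close> by runner gives a pairing symmetric in
  \<open>A\<close> and \<open>B\<close>; for \<open>A = B\<close> it is the sum of squares in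
  \<open>potential\<close>.\<close>

lemma sum_runner_count:
  assumes "finite A" "0 < n"
  shows "(\<Sum>p\<in>A. runner_count n B (snd p)) = (\<Sum>c\<in>{0..<n}. runner_count n A c * runner_count n B c)"
proof -
  have "(\<Sum>p\<in>A. runner_count n B (snd p)) = (\<Sum>p\<in>A. \<Sum>c\<in>{0..<n}. of_bool (snd p mod n = c mod n) * runner_count n B c)"
  proof (rule sum.cong[OF refl])
    fix p
    have "(\<Sum>c\<in>{0..<n}. of_bool (snd p mod n = c mod n) * runner_count n B c)
        = (\<Sum>c\<in>{0..<n}. if c = snd p mod n then runner_count n B c else 0)"
      by (rule sum.cong) auto
    also have "\<dots> = runner_count n B (snd p)"
      using assms(2) by simp
    finally show "runner_count n B (snd p)
      = (\<Sum>c\<in>{0..<n}. of_bool (snd p mod n = c mod n) * runner_count n B c)" ..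
  qed
  also have "\<dots> = (\<Sum>c\<in>{0..<n}. runner_count n A c * runner_count n B c)"
    by (subst sum.swap) (simp add: runner_count_sum[OF assms(1)] sum_distrib_right)
  finally show ?thesis .
qed

section \<open>Change of the potential under elementary operations\<close>

lemma potential_move:
  assumes "finite S" "p \<in> S" "q \<notin> S" "snd q mod n = snd p mod n"
  shows "potential n r (insert q (S - {p}))
    = potential n r S + bead_potential n r q - bead_potential n r p"
proof -
  have sum: "(\<Sum>x\<in>insert q (S - {p}). f x) = (\<Sum>x\<in>S. f x) + f q - f p" for f :: "nat \<times> int \<Rightarrow> int"
    using assms by (simp add: sum_diff1)
  have "runner_count n (insert q (S - {p})) c = runner_count n S c" for c
    using assms(1,4) by (simp only: runner_count_sum finite_insert finite_Diff sum)
  then show ?thesis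
    by (simp add: potential_def sum)
qed

text \<open>The bead stays on its runner, so the quadratic term does not change. In the first kind
  the row index grows by 1, which costs 2. In the second kind \<open>y div n\<close> drops by 1,
  which costs \<open>2 r\<close>, while the row index falls from \<open>r\<close> to 1, which
  regains \<open>2 (r - 1)\<close>.\<close>

lemma elementary_op_potential:
  assumes "elementary_op (enat n) r x A B" "1 \<le> r" "0 < n"
    and "full_below r L A" "finite (beads_above L A)"
  shows "full_below r L B" "finite (beads_above L B)"
    "potential (int n) r (beads_above L B) = potential (int n) r (beads_above L A) - 2"
    "card (beads_above L B) = card (beads_above L A)" "x \<in> {1..r}"
proof -
  obtain q p where B: "B = insert q (A - {p})" and p: "p \<in> A" "q \<notin> A"
    and rows: "fst p \<in> {1..r}" "fst q \<in> {1..r}" "x = fst p"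
    and le: "snd q \<le> snd p" "snd q mod int n = snd p mod int n"
    and drop: "bead_potential (int n) r q = bead_potential (int n) r p - 2"
    using assms(1)
  proof cases
    case (first_kind y)
    then show ?thesis
      using assms(2) that[of "(x + 1, y)" "(x, y)"] by (auto simp: bead_potential_def)
  next
    case (second_kind m y)
    have "(y - int n) div int n = y div int n - 1"
      using assms(3) div_add_self2[of "int n" "y - int n"] by simp
    then have "bead_potential (int n) r (1, y - int n) = bead_potential (int n) r (r, y) - 2"
      by (simp only: bead_potential_def fst_conv snd_conv) (simp add: algebra_simps)
    then show ?thesis
      using assms(2) second_kind that[of "(1, y - int n)" "(r, y)"] by auto
  qed
  \<comment> \<open>The target is vacant, and no position below \<open>L\<close> is; hence the whole
    move is visible in the truncated abacus.\<close>
  have q: "L \<le> snd q"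
    using p(2) rows(2) assms(4) unfolding full_below_def by (cases q) force
  with le have p': "L \<le> snd p" by simp
  have eq: "beads_above L B = insert q (beads_above L A - {p})"
    using B q by (auto simp: beads_above_def)
  have mem: "p \<in> beads_above L A" "q \<notin> beads_above L A"
    using p p' by (auto simp: beads_above_def)
  show "full_below r L B"
    using assms(4) p' unfolding full_below_def B by force
  show "finite (beads_above L B)" using assms(5) eq by simp
  show "potential (int n) r (beads_above L B) = potential (int n) r (beads_above L A) - 2"
    unfolding eq potential_move[OF assms(5) mem le(2)] drop by simp
  show "card (beads_above L B) = card (beads_above L A)"
    unfolding eq using assms(5) mem
    by (metis card_Suc_Diff1 card_insert_disjoint finite_Diff DiffD1)
  show "x \<in> {1..r}" using rows by simp
qed

lemma elementary_ops_potential: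
  assumes "elementary_ops (enat n) r xs A B" "1 \<le> r" "0 < n"
    and "full_below r L A" "finite (beads_above L A)"
  shows "full_below r L B \<and> finite (beads_above L B) \<and>
    potential (int n) r (beads_above L A) = potential (int n) r (beads_above L B) + 2 * int (length xs) \<and>
    card (beads_above L B) = card (beads_above L A) \<and> set xs \<subseteq> {1..r}"
  using assms
proof (induction rule: elementary_ops.induct)
  case (no_op A)
  then show ?case by simp
next
  case (one_more_op x A B xs C)
  note * = elementary_op_potential[OF one_more_op.hyps(1) one_more_op.prems]
  show ?case
    using one_more_op.IH[OF one_more_op.prems(1,2) *(1,2)] *(3-5) by auto
qed


section \<open>Complete abaci\<close>

text \<open>For \<open>l \<le> r\<close>, there are \<open>l - 1\<close> indices below
  \<open>l\<close> and \<open>r - l\<close> above it. The other branch carries the induction on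
  \<open>r\<close> up to \<open>l\<close>.\<close>

lemma sum_sgn_row:
  "1 \<le> l \<Longrightarrow> (\<Sum>k = 1..r. sgn (int l - int k)) = (if l \<le> r then 2 * int l - int r - 1 else int r)"
  by (induction r) (auto simp: not_le le_Suc_eq)

text \<open>The double sum of the squared differences is computed twice. Expanded, it is twice the
  left side. Written with signs, it splits into two halves exchanged by swapping \<open>k\<close>
  and \<open>l\<close>, each equal to the right side by \<open>sum_sgn_row\<close>.\<close>

lemma sum_squares_chain:
  fixes K :: "nat \<Rightarrow> int"
  assumes "\<And>k l. 1 \<le> k \<Longrightarrow> k \<le> l \<Longrightarrow> l \<le> r \<Longrightarrow> K k \<le> K l \<and> K l \<le> K k + 1"
  shows "int r * (\<Sum>k = 1..r. (K k)\<^sup>2) - (\<Sum>k = 1..r. K k)\<^sup>2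
    = (\<Sum>k = 1..r. (2 * int k - int r - 1) * K k)"
proof -
  have "(\<Sum>k = 1..r. \<Sum>l = 1..r. (K k - K l)\<^sup>2) = (\<Sum>k = 1..r. \<Sum>l = 1..r. (K k)\<^sup>2 + (K l)\<^sup>2 - 2 * (K k * K l))"
    by (simp add: power2_diff mult.assoc)
  also have "\<dots> = 2 * (int r * (\<Sum>k = 1..r. (K k)\<^sup>2) - (\<Sum>k = 1..r. K k)\<^sup>2)"
    by (simp add: sum.distrib sum_subtractf power2_eq_square sum_product flip: sum_distrib_left)
  finally have 1: "(\<Sum>k = 1..r. \<Sum>l = 1..r. (K k - K l)\<^sup>2)
    = 2 * (int r * (\<Sum>k = 1..r. (K k)\<^sup>2) - (\<Sum>k = 1..r. K k)\<^sup>2)" .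
  txt \<open>All differences are 0 or 1, hence equal to their squares.\<close>
  have "(K k - K l)\<^sup>2 = sgn (int k - int l) * K k + sgn (int l - int k) * K l"
    if "k \<in> {1..r}" "l \<in> {1..r}" for k l
  proof -
    have *: "(K b - K a)\<^sup>2 = K b - K a" if "a \<le> b" "1 \<le> a" "b \<le> r" for a b
    proof -
      have "K b - K a = 0 \<or> K b - K a = 1" using assms[OF that(2,1,3)] by auto
      then show ?thesis by auto
    qed
    show ?thesis
      using *[of k l] *[of l k] that by (cases k l rule: linorder_cases) (auto simp: power2_commute)
  qed
  then have "(\<Sum>k = 1..r. \<Sum>l = 1..r. (K k - K l)\<^sup>2)
    = (\<Sum>k = 1..r. \<Sum>l = 1..r. sgn (int k - int l) * K k + sgn (int l - int k) * K l)"
    by (intro sum.cong refl) auto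
  also have "\<dots> = (\<Sum>k = 1..r. \<Sum>l = 1..r. sgn (int k - int l) * K k) + (\<Sum>k = 1..r. \<Sum>l = 1..r. sgn (int l - int k) * K l)"
    by (simp add: sum.distrib)
  also have "(\<Sum>k = 1..r. \<Sum>l = 1..r. sgn (int l - int k) * K l) = (\<Sum>k = 1..r. \<Sum>l = 1..r. sgn (int k - int l) * K k)"
    by (rule sum.swap)
  also have "(\<Sum>k = 1..r. \<Sum>l = 1..r. sgn (int k - int l) * K k) = (\<Sum>k = 1..r. (2 * int k - int r - 1) * K k)"
    by (intro sum.cong refl, subst sum_distrib_right[symmetric], subst sum_sgn_row) auto
  finally show ?thesis using 1 by simp
qed

text \<open>Closure under predecessors down to \<open>m\<close> forces a nonempty \<open>J\<close>
  to be an interval starting at \<open>m\<close>, so its elements form an arithmetic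
  progression.\<close>

lemma sum_initial_segment:
  fixes J :: "int set"
  assumes "finite J" "\<And>j. j \<in> J \<Longrightarrow> m \<le> j" "\<And>j. j \<in> J \<Longrightarrow> m < j \<Longrightarrow> j - 1 \<in> J"
  shows "2 * (\<Sum>j\<in>J. j) = int (card J) * (2 * m + int (card J) - 1)"
proof (cases "J = {}")
  case False
  have down: "j \<in> J" if "j \<le> Max J" "m \<le> j" for j
    using that
  proof (induction j rule: int_le_induct)
    case base
    then show ?case using assms(1) False by simp
  next
    case (step i)
    then show ?case using assms(3)[of i] by simp
  qed
  have J: "J = {m..Max J}"
  proof
    show "J \<subseteq> {m..Max J}" using assms(1,2) by auto
    show "{m..Max J} \<subseteq> J" using down by (meson atLeastAtMost_iff subsetI)
  qed
  have "m \<le> Max J" using assms(2) False assms(1) by simp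
  have sum: "2 * (\<Sum>j\<in>{m..m + int k}. j) = int (Suc k) * (2 * m + int k)" for k
  proof (induction k)
    case (Suc k)
    have "{m..m + int (Suc k)} = insert (m + int (Suc k)) {m..m + int k}" by auto
    then show ?case using Suc by (simp add: algebra_simps)
  qed simp
  obtain k where k: "Max J = m + int k"
    using \<open>m \<le> Max J\<close> zle_iff_zadd by auto
  show ?thesis
    using sum[of k] J by (simp add: k)
qed simp

text \<open>On each runner the beads of a row fill the levels \<open>m\<close>,
  \<open>m + 1\<close>, ... without gaps, so their number \<open>K k c\<close> determines their
  contribution. The numbers in the different rows form a chain as in
  \<open>sum_squares_chain\<close>, which cancels the quadratic terms against the row terms and
  leaves a multiple of the number of beads.\<close>

lemma potential_complete:
  fixes X :: "nat \<Rightarrow> int set"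
  assumes n: "0 < n" and L: "L = n * m" and S: "S = {(k, y). k \<in> {1..r} \<and> y \<in> X k \<and> L \<le> y}" "finite S"
    and mono: "\<And>k l. 1 \<le> k \<Longrightarrow> k \<le> l \<Longrightarrow> l \<le> r \<Longrightarrow> X k \<subseteq> X l"
    and wrap: "\<And>y. y \<in> X r \<Longrightarrow> y - n \<in> X 1"
  shows "potential n r S = (2 * m - 1) * int r * int (card S)"
proof -
  define T where "T k c = {y \<in> X k. L \<le> y \<and> y mod n = c}" for k c
  define K where "K k c = int (card (T k c))" for k c
  have fin: "finite (T k c)" if "k \<in> {1..r}" for k c
    by (rule finite_subset[OF _ finite_imageI[OF S(2), of snd]]) (use that in \<open>force simp: T_def S(1)\<close>)
  have sumS: "(\<Sum>p\<in>S. f p) = (\<Sum>c\<in>{0..<n}. \<Sum>k = 1..r. \<Sum>y\<in>T k c. f (k, y))"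
    for f :: "nat \<times> int \<Rightarrow> int"
  proof -
    have "(\<Sum>c\<in>{0..<n}. \<Sum>k = 1..r. \<Sum>y\<in>T k c. f (k, y))
      = (\<Sum>(c, k, y)\<in>(SIGMA c:{0..<n}. SIGMA k:{1..r}. T k c). f (k, y))"
    proof -
      have "(\<Sum>k = 1..r. \<Sum>y\<in>T k c. f (k, y)) = (\<Sum>p\<in>(SIGMA k:{1..r}. T k c). f p)" for c
        using fin by (subst sum.Sigma) auto
      moreover have "finite (SIGMA k:{1..r}. T k c)" for c
        using fin by (intro finite_SigmaI) auto
      ultimately show ?thesis
        by (simp add: sum.Sigma case_prod_beta del: One_nat_def)
    qed
    also have "\<dots> = (\<Sum>p\<in>S. f p)"
      by (rule sum.reindex_bij_witness[of _ "\<lambda>(k, y). (y mod n, k, y)" "\<lambda>(c, k, y). (k, y)"])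
        (use n in \<open>auto simp: S(1) T_def\<close>)
    finally show ?thesis ..
  qed
  have count: "runner_count n S c = (\<Sum>k = 1..r. K k c)" if "c \<in> {0..<n}" for c
  proof -
    have "{p \<in> S. snd p mod n = c mod n} = (SIGMA k:{1..r}. T k c)"
      using that by (auto simp: S(1) T_def)
    then show ?thesis
      using fin by (simp add: runner_count_def K_def)
  qed
  have energy: "2 * (\<Sum>y\<in>T k c. y div n) = K k c * (2 * m + K k c - 1)" if k: "k \<in> {1..r}" for k c
  proof -
    have inj: "inj_on (\<lambda>y. y div n) (T k c)"
      by (rule inj_onI) (metis (mono_tags, lifting) T_def div_mult_mod_eq mem_Collect_eq)
    have "2 * (\<Sum>j\<in>(\<lambda>y. y div n) ` T k c. j) = int (card ((\<lambda>y. y div n) ` T k c)) * (2 * m + int (card ((\<lambda>y. y div n) ` T k c)) - 1)"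
    proof (rule sum_initial_segment)
      show "finite ((\<lambda>y. y div n) ` T k c)" using fin[OF k] by simp
      show le: "m \<le> j" if "j \<in> (\<lambda>y. y div n) ` T k c" for j
        using that n unfolding T_def L by (auto simp: zdiv_mono1 dest: zdiv_mono1[where b = n])
      show "j - 1 \<in> (\<lambda>y. y div n) ` T k c" if j: "j \<in> (\<lambda>y. y div n) ` T k c" "m < j" for j
      proof -
        obtain y where y: "y \<in> T k c" "j = y div n" using j by auto
        \<comment> \<open>From \<open>X k\<close> pass up to \<open>X r\<close>, wrap around to
          \<open>X 1\<close>, and return to \<open>X k\<close>.\<close>
        have "y - n \<in> X k"
          using y(1) mono[of k r] mono[of 1 k] wrap[of y] k by (auto simp: T_def)
        moreover have "L \<le> y - n"
        proof -
          have "n * (m + 1) \<le> n * (y div n)" using j(2) y(2) n by (intro mult_left_mono) auto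
          also have "\<dots> \<le> y" using n by (metis le_add_same_cancel1 mult_div_mod_eq pos_mod_sign)
          finally show ?thesis by (simp add: L algebra_simps)
        qed
        moreover have "(y - n) div n = j - 1"
          using y(2) n div_add_self2[of n "y - n"] by simp
        ultimately show ?thesis using y(1) by (force simp: T_def)
      qed
    qed
    then show ?thesis using inj by (simp add: sum.reindex card_image K_def)
  qed
  have chain: "K k c \<le> K l c \<and> K l c \<le> K k c + 1" if "1 \<le> k" "k \<le> l" "l \<le> r" for k l c
  proof
    have mem: "k \<in> {1..r}" "l \<in> {1..r}" using that by auto
    show "K k c \<le> K l c"
      using mono[OF that] fin[OF mem(2)] unfolding K_def by (intro of_nat_mono card_mono) (auto simp: T_def)
    \<comment> \<open>Wrapping around sends a bead of row \<open>l\<close> to row \<open>k\<close>,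
      one level lower. Since \<open>n\<close> divides \<open>L\<close>, the first column of runner
      \<open>c\<close> from \<open>L\<close> on is \<open>L + c\<close>; only a bead there can be
      pushed below \<open>L\<close>.\<close>
    have "T l c \<subseteq> insert (L + c) ((\<lambda>y. y + n) ` T k c)"
    proof
      fix y assume y: "y \<in> T l c"
      have X: "y - n \<in> X k"
        using y that mono[of l r] mono[of 1 k] wrap[of y] by (auto simp: T_def)
      show "y \<in> insert (L + c) ((\<lambda>y. y + n) ` T k c)"
      proof (cases "L \<le> y - n")
        case True
        then have "y - n \<in> T k c" using X y by (auto simp: T_def)
        then show ?thesis by force
      next
        case False
        have "(y - L) mod n = c" using y mod_mult_self2[of y n "- m"] by (simp add: T_def L)
        moreover have "(y - L) mod n = y - L" using False y by (simp add: T_def)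
        ultimately show ?thesis by simp
      qed
    qed
    then have "card (T l c) \<le> card (insert (L + c) ((\<lambda>y. y + n) ` T k c))"
      using fin[OF mem(1)] by (intro card_mono) auto
    also have "\<dots> \<le> Suc (card (T k c))"
      using fin[OF mem(1)] card_image_le[of "T k c" "\<lambda>y. y + n"] by (simp add: card_insert_if)
    finally show "K l c \<le> K k c + 1" by (simp add: K_def)
  qed
  have "potential n r S = (\<Sum>c\<in>{0..<n}. (\<Sum>k = 1..r. \<Sum>y\<in>T k c. bead_potential n r (k, y)) - (\<Sum>k = 1..r. K k c)\<^sup>2)"
    by (simp add: potential_def sumS count sum_subtractf)
  also have "\<dots> = (\<Sum>c\<in>{0..<n}. \<Sum>k = 1..r. (2 * m - 1) * int r * K k c)"
  proof (rule sum.cong[OF refl])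
    fix c
    have "(\<Sum>y\<in>T k c. bead_potential n r (k, y))
      = int r * (K k c)\<^sup>2 - (2 * int k - int r - 1) * K k c + (2 * m - 1) * int r * K k c"
      if "k \<in> {1..r}" for k
    proof -
      have "(\<Sum>y\<in>T k c. bead_potential n r (k, y))
        = int r * (2 * (\<Sum>y\<in>T k c. y div n)) - (2 * int k - int r - 1) * K k c"
        by (simp add: bead_potential_def sum.distrib sum_subtractf K_def sum_distrib_left algebra_simps)
      then show ?thesis
        by (simp add: energy[OF that] power2_eq_square algebra_simps)
    qed
    then have "(\<Sum>k = 1..r. \<Sum>y\<in>T k c. bead_potential n r (k, y))
      = int r * (\<Sum>k = 1..r. (K k c)\<^sup>2) - (\<Sum>k = 1..r. (2 * int k - int r - 1) * K k c)
        + (\<Sum>k = 1..r. (2 * m - 1) * int r * K k c)"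
      by (simp add: sum.distrib sum_subtractf sum_distrib_left)
    then show "(\<Sum>k = 1..r. \<Sum>y\<in>T k c. bead_potential n r (k, y)) - (\<Sum>k = 1..r. K k c)\<^sup>2
      = (\<Sum>k = 1..r. (2 * m - 1) * int r * K k c)"
      using sum_squares_chain[of r "\<lambda>k. K k c"] chain by simp
  qed
  also have "\<dots> = (2 * m - 1) * int r * int (card S)"
    using sumS[of "\<lambda>_. 1"] by (simp add: K_def flip: sum_distrib_left)
  finally show ?thesis .
qed


section \<open>The weight as a difference of potentials\<close>

text \<open>The condition \<open>L \<le> s k\<close> makes the parts \<open>1, \<dots>, s k - L\<close> correspond exactly to the beads
  of row \<open>k\<close> from column \<open>L\<close> on.\<close>

definition deep_level :: "nat \<Rightarrow> (nat \<Rightarrow> int) \<Rightarrow> (nat \<Rightarrow> parts) \<Rightarrow> int \<Rightarrow> bool" where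
  "deep_level r s lam L \<longleftrightarrow>
     (\<forall>k\<in>{1..r}. L \<le> s k \<and> (\<forall>j\<ge>1. s k - int j < L \<longrightarrow> lam k j = 0))"

text \<open>All levels below the bound are supplied, so that a multiple of \<open>n\<close> can be
  chosen later.\<close>

lemma deep_level_exists:
  assumes "multipartition r lam"
  obtains L0 where "\<And>L. L \<le> L0 \<Longrightarrow> deep_level r s lam L"
proof -
  have "\<exists>L. L \<le> s k \<and> (\<forall>j\<ge>1. s k - int j < L \<longrightarrow> lam k j = 0)" if "k \<in> {1..r}" for k
  proof -
    have "finite {i. 1 \<le> i \<and> lam k i \<noteq> 0}"
      using assms that by (auto simp: multipartition_def partition_def)
    then obtain N where N: "{i. 1 \<le> i \<and> lam k i \<noteq> 0} \<subseteq> {..N}"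
      using finite_nat_iff_bounded_le by blast
    have "lam k j = 0" if "1 \<le> j" "s k - int j < s k - int N" for j
      using that N by fastforce
    then show ?thesis by (intro exI[of _ "s k - int N"]) auto
  qed
  then obtain f where f: "\<And>k. k \<in> {1..r} \<Longrightarrow> f k \<le> s k \<and> (\<forall>j\<ge>1. s k - int j < f k \<longrightarrow> lam k j = 0)"
    by metis
  obtain L0 where L0: "\<And>k. k \<in> {1..r} \<Longrightarrow> L0 \<le> f k"
  \<comment> \<open>\<open>Min\<close> needs a nonempty set; for \<open>r = 0\<close> any bound
    serves.\<close>
  proof (cases "r = 0")
    case False
    then show ?thesis using that[of "Min (f ` {1..r})"] by simp
  qed (use that in simp)
  show ?thesis
  proof
    fix L assume "L \<le> L0"
    then show "deep_level r s lam L"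
      unfolding deep_level_def using f L0 by (meson order.trans order.strict_trans2)
  qed
qed

section \<open>Beads from column \<open>L\<close> on, indexed by parts\<close>

lemma sum_vacuum_above:
  assumes "deep_level r s lam L"
  shows "finite (beads_above L (vacuum r s))"
    and "(\<Sum>p\<in>beads_above L (vacuum r s). f p)
      = (\<Sum>(k, i)\<in>(SIGMA k:{1..r}. {1..nat (s k - L)}). f (k, s k - int i))"
proof -
  let ?P = "SIGMA k:{1..r}. {1..nat (s k - L)}" and ?h = "\<lambda>(k, i). (k, s k - int i)"
  have eq: "beads_above L (vacuum r s) = ?h ` ?P"
  proof (intro set_eqI iffI)
    fix p assume p: "p \<in> beads_above L (vacuum r s)"
    obtain k y where "p = (k, y)" by force
    with p show "p \<in> ?h ` ?P"
      by (intro image_eqI[of _ _ "(k, nat (s k - y))"]) (auto simp: beads_above_def vacuum_def)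
  qed (auto simp: beads_above_def vacuum_def)
  show "finite (beads_above L (vacuum r s))" unfolding eq by simp
  have "inj_on ?h ?P" by (auto simp: inj_on_def)
  then show "(\<Sum>p\<in>beads_above L (vacuum r s). f p) = (\<Sum>(k, i)\<in>?P. f (k, s k - int i))"
    unfolding eq by (subst sum.reindex) (auto intro!: sum.cong)
qed

text \<open>The index set is that of \<open>sum_vacuum_above\<close>, so the two abaci can be
  compared part by part. Distinct parts give distinct beads because \<open>lam k i - i\<close>
  strictly decreases in \<open>i\<close>.\<close>

lemma sum_beads_above:
  assumes "multipartition r lam" "deep_level r s lam L"
  shows "finite (beads_above L (abacus r s lam))"
    and "(\<Sum>p\<in>beads_above L (abacus r s lam). f p)
      = (\<Sum>(k, i)\<in>(SIGMA k:{1..r}. {1..nat (s k - L)}). f (k, int (lam k i) - int i + s k))"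
proof -
  let ?P = "SIGMA k:{1..r}. {1..nat (s k - L)}" and ?h = "\<lambda>(k, i). (k, int (lam k i) - int i + s k)"
  have eq: "beads_above L (abacus r s lam) = ?h ` ?P"
  proof (intro set_eqI iffI)
    fix p assume p: "p \<in> beads_above L (abacus r s lam)"
    then obtain k i where ki: "p = (k, int (lam k i) - int i + s k)" "k \<in> {1..r}" "1 \<le> i"
      by (auto simp: beads_above_def abacus_def beads_def)
    \<comment> \<open>Otherwise the part is zero and its bead sits at \<open>s k - i\<close>, to the
      left of \<open>L\<close>.\<close>
    have "L \<le> s k - int i"
    proof (rule ccontr)
      assume "\<not> L \<le> s k - int i"
      moreover from this have "lam k i = 0"
        using assms(2) ki(2,3) by (auto simp: deep_level_def)
      ultimately show False using p ki(1) by (simp add: beads_above_def)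
    qed
    then show "p \<in> ?h ` ?P"
      using ki by (intro image_eqI[of _ _ "(k, i)"]) auto
  qed (auto simp: beads_above_def abacus_def beads_def)
  show "finite (beads_above L (abacus r s lam))" unfolding eq by simp
  have less: "int (lam k j) - int j < int (lam k i) - int i" if "k \<in> {1..r}" "1 \<le> i" "i < j" for k i j
  proof -
    have "lam k j \<le> lam k i"
      using assms(1) that by (auto simp: multipartition_def partition_def)
    then show ?thesis using that by simp
  qed
  have "inj_on ?h ?P"
  proof (rule inj_onI)
    fix p q assume *: "p \<in> ?P" "q \<in> ?P" "?h p = ?h q"
    obtain k i j where "p = (k, i)" "q = (k, j)"
      using *(3) by (cases p; cases q) auto
    then show "p = q"
      using * less[of k i j] less[of k j i] by (cases i j rule: linorder_cases) auto
  qed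
  then show "(\<Sum>p\<in>beads_above L (abacus r s lam). f p) = (\<Sum>(k, i)\<in>?P. f (k, int (lam k i) - int i + s k))"
    unfolding eq by (subst sum.reindex) (auto intro!: sum.cong)
qed

text \<open>Both abaci have equally many beads from \<open>L\<close> on in each row. This serves for
  the row terms of the potential and for the total number of beads.\<close>

lemma sum_rows_above:
  assumes "multipartition r lam" "deep_level r s lam L"
  shows "(\<Sum>p\<in>beads_above L (abacus r s lam). f (fst p)) = (\<Sum>p\<in>beads_above L (vacuum r s). f (fst p))"
  by (simp add: sum_beads_above[OF assms] sum_vacuum_above[OF assms(2)] case_prod_beta)

section \<open>Telescoping over the nodes, with residues lifted to integers\<close>

definition node_content :: "(nat \<Rightarrow> int) \<Rightarrow> nat \<times> nat \<times> nat \<Rightarrow> int" where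
  "node_content s = (\<lambda>(i, j, k). int j - int i + s k)"

text \<open>The contents along row \<open>i\<close> of component \<open>k\<close> run from
  \<open>s k - i + 1\<close> to \<open>s k - i + lam k i\<close>. The differences telescope to the
  value at the bead of that part minus the value at \<open>s k - i\<close>, the corresponding bead
  of the vacuum.\<close>

lemma sum_nodes_telescope:
  fixes F :: "int \<Rightarrow> int"
  assumes "multipartition r lam" "deep_level r s lam L"
  shows "finite (nodes r lam)"
    and "(\<Sum>x\<in>nodes r lam. F (node_content s x) - F (node_content s x - 1))
      = (\<Sum>p\<in>beads_above L (abacus r s lam). F (snd p)) - (\<Sum>p\<in>beads_above L (vacuum r s). F (snd p))"
proof -
  let ?P = "SIGMA k:{1..r}. {1..nat (s k - L)}"
  let ?Q = "SIGMA q:?P. {1..lam (fst q) (snd q)}"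
  have eq: "nodes r lam = (\<lambda>((k, i), j). (i, j, k)) ` ?Q"
  proof (intro set_eqI iffI)
    fix x assume "x \<in> nodes r lam"
    then obtain i j k where x: "x = (i, j, k)" "1 \<le> i" "1 \<le> j" "j \<le> lam k i" "k \<in> {1..r}"
      by (auto simp: nodes_def)
    then have "\<not> s k - int i < L"
      using assms(2) by (force simp: deep_level_def)
    then show "x \<in> (\<lambda>((k, i), j). (i, j, k)) ` ?Q"
      using x by (intro image_eqI[of _ _ "((k, i), j)"]) auto
  qed (auto simp: nodes_def)
  show "finite (nodes r lam)" unfolding eq by (intro finite_imageI finite_SigmaI) auto
  have inj: "inj_on (\<lambda>((k, i), j). (i, j, k)) ?Q" by (auto simp: inj_on_def)
  have tel: "(\<Sum>j = 1..m. F (int j + a) - F (int j + a - 1)) = F (int m + a) - F a" for m a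
    by (induction m) (auto simp: algebra_simps)
  have "(\<Sum>x\<in>nodes r lam. F (node_content s x) - F (node_content s x - 1))
    = (\<Sum>(q, j)\<in>?Q. F (int j + (s (fst q) - int (snd q))) - F (int j + (s (fst q) - int (snd q)) - 1))"
    unfolding eq sum.reindex[OF inj] by (rule sum.cong) (auto simp: node_content_def algebra_simps)
  also have "\<dots> = (\<Sum>q\<in>?P. F (int (lam (fst q) (snd q)) + (s (fst q) - int (snd q))) - F (s (fst q) - int (snd q)))"
    by (subst sum.Sigma[symmetric]) (auto simp: tel simp del: One_nat_def)
  finally show "(\<Sum>x\<in>nodes r lam. F (node_content s x) - F (node_content s x - 1))
      = (\<Sum>p\<in>beads_above L (abacus r s lam). F (snd p)) - (\<Sum>p\<in>beads_above L (vacuum r s). F (snd p))"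
    by (simp add: sum_beads_above[OF assms] sum_vacuum_above[OF assms(2)] case_prod_beta
        sum_subtractf algebra_simps)
qed

text \<open>The affine Cartan matrix on integer representatives, as a negated second difference of
  the congruence indicator. For \<open>n = 2\<close> the last two terms coincide and give the entry
  -2.\<close>

definition cartan_mod :: "int \<Rightarrow> int \<Rightarrow> int \<Rightarrow> int" where
  "cartan_mod n a b = 2 * of_bool (a mod n = b mod n)
     - of_bool (a mod n = (b + 1) mod n) - of_bool (a mod n = (b - 1) mod n)"

lemma mod_eq_shift: "((a::int) mod n = (b + 1) mod n) = ((a - 1) mod n = b mod n)"
  by (simp add: mod_eq_dvd_iff algebra_simps)

text \<open>The floor quotient jumps exactly at multiples of \<open>n\<close>; this makes the
  indicator of divisibility a difference that can be telescoped.\<close>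

lemma div_minus_div_pred:
  fixes n :: int
  assumes "0 < n"
  shows "a div n - (a - 1) div n = of_bool (n dvd a)"
proof (cases "n dvd a")
  case True
  then obtain q where "a = n * q" by auto
  moreover have "(n * q - 1) div n = q - 1"
    by (rule int_div_pos_eq[where r = "n - 1"]) (use assms in \<open>auto simp: algebra_simps\<close>)
  ultimately show ?thesis using assms by simp
next
  case False
  then have "a mod n \<noteq> 0" by (simp add: dvd_eq_mod_eq_0)
  then have "0 \<le> a mod n - 1" using assms by (metis pos_mod_sign add_le_imp_le_diff int_one_le_iff_zero_less order_le_less add_0)
  moreover have "a - 1 = n * (a div n) + (a mod n - 1)" by simp
  moreover have "a mod n - 1 < n" using assms pos_mod_bound[of n a] by linarith
  ultimately have "(a - 1) div n = a div n" by (intro int_div_pos_eq)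
  then show ?thesis using False by simp
qed

text \<open>In each row the indicators telescope over the columns from \<open>L\<close> to
  \<open>s k - 1\<close>. The upper end contributes the condition on \<open>s k\<close>, and the
  lower end, as \<open>n\<close> divides \<open>L\<close>, contributes \<open>n dvd a\<close>. Thus
  the multiplicity of a fundamental weight in the dominant weight is itself a difference in
  \<open>a\<close>.\<close>

lemma runner_count_vacuum_diff:
  assumes "0 < n" "n dvd L" "deep_level r s lam L"
  shows "runner_count n (beads_above L (vacuum r s)) a - runner_count n (beads_above L (vacuum r s)) (a - 1)
    = int r * (a div n - (a - 1) div n) - int (card {k \<in> {1..r}. s k mod n = a mod n})"
proof -
  let ?G = "\<lambda>k i. of_bool ((s k - int i) mod n = a mod n) :: int"
  have tel: "(\<Sum>i = 1..m. of_bool ((s k - int i) mod n = a mod n) - of_bool ((s k - int i) mod n = (a - 1) mod n))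
      = ?G k m - ?G k 0" for k m
  proof -
    have "((s k - int (Suc i)) mod n = (a - 1) mod n) = ((s k - int i) mod n = a mod n)" for i
      by (simp add: mod_eq_dvd_iff algebra_simps)
    then show ?thesis by (induction m) auto
  qed
  have "runner_count n (beads_above L (vacuum r s)) a - runner_count n (beads_above L (vacuum r s)) (a - 1)
    = (\<Sum>p\<in>beads_above L (vacuum r s). of_bool (snd p mod n = a mod n) - of_bool (snd p mod n = (a - 1) mod n))"
    by (simp add: runner_count_sum sum_vacuum_above(1)[OF assms(3)] sum_subtractf)
  also have "\<dots> = (\<Sum>k = 1..r. \<Sum>i = 1..nat (s k - L).
      of_bool ((s k - int i) mod n = a mod n) - of_bool ((s k - int i) mod n = (a - 1) mod n))"
    by (simp add: sum_vacuum_above(2)[OF assms(3)] sum.Sigma del: One_nat_def)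
  also have "\<dots> = (\<Sum>k = 1..r. of_bool (n dvd a) - of_bool (s k mod n = a mod n))"
  proof (rule sum.cong[OF refl])
    fix k assume "k \<in> {1..r}"
    then have "s k - int (nat (s k - L)) = L" using assms(3) by (auto simp: deep_level_def)
    moreover have "(L mod n = a mod n) = (n dvd a)"
      using assms(2) by (metis dvd_eq_mod_eq_0)
    ultimately show "(\<Sum>i = 1..nat (s k - L).
        of_bool ((s k - int i) mod n = a mod n) - of_bool ((s k - int i) mod n = (a - 1) mod n))
      = of_bool (n dvd a) - (of_bool (s k mod n = a mod n) :: int)"
      unfolding tel by simp
  qed
  also have "\<dots> = int r * of_bool (n dvd a) - int (card {k \<in> {1..r}. s k mod n = a mod n})"
    by (simp add: sum_subtractf of_bool_def sum.If_cases Int_def)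
  finally show ?thesis by (simp add: div_minus_div_pred[OF assms(1)])
qed

text \<open>The pairing with the dominant weight telescopes once and the Cartan double sum twice,
  once in each node. Both become sums of runner counts over beads, where \<open>uu\<close>,
  \<open>uz\<close>, \<open>zz\<close> pair the abacus of \<open>lam\<close> and the vacuum with
  each other and themselves.\<close>

lemma potential_diff_nodes:
  assumes "0 < n" "n dvd L" "multipartition r lam" "deep_level r s lam L"
  shows "potential n r (beads_above L (abacus r s lam)) - potential n r (beads_above L (vacuum r s))
    = 2 * (\<Sum>x\<in>nodes r lam. int (card {k \<in> {1..r}. s k mod n = node_content s x mod n}))
      - (\<Sum>x\<in>nodes r lam. \<Sum>y\<in>nodes r lam. cartan_mod n (node_content s x) (node_content s y))"
proof -
  let ?U = "beads_above L (abacus r s lam)" and ?Z = "beads_above L (vacuum r s)"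
  let ?N = "nodes r lam" and ?c = "node_content s"
  define uu where "uu = (\<Sum>p\<in>?U. runner_count n ?U (snd p))"
  define uz where "uz = (\<Sum>p\<in>?U. runner_count n ?Z (snd p))"
  define zz where "zz = (\<Sum>p\<in>?Z. runner_count n ?Z (snd p))"
  note fin = sum_beads_above(1)[OF assms(3,4)] sum_vacuum_above(1)[OF assms(4)]
  note tel = sum_nodes_telescope(2)[OF assms(3,4)]
  have zu: "(\<Sum>p\<in>?Z. runner_count n ?U (snd p)) = uz"
    using fin assms(1) by (simp add: uz_def sum_runner_count mult.commute)
  have pot: "potential n r S = 2 * (int r * (\<Sum>p\<in>S. snd p div n)) + (\<Sum>p\<in>S. int r + 1 - 2 * int (fst p))
      - (\<Sum>p\<in>S. runner_count n S (snd p))" if "finite S" for S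
    using that assms(1)
    by (simp add: potential_def bead_potential_def sum_runner_count power2_eq_square sum_distrib_left algebra_simps flip: sum.distrib)
  have linear: "(\<Sum>x\<in>?N. int (card {k \<in> {1..r}. s k mod n = ?c x mod n}))
    = int r * (\<Sum>p\<in>?U. snd p div n) - int r * (\<Sum>p\<in>?Z. snd p div n) - uz + zz"
  proof -
    \<comment> \<open>By \<open>runner_count_vacuum_diff\<close>, the differences of this function
      are the multiplicities in the dominant weight.\<close>
    define F where "F a = int r * (a div n) - runner_count n ?Z a" for a
    have "int (card {k \<in> {1..r}. s k mod n = a mod n}) = F a - F (a - 1)" for a
      using runner_count_vacuum_diff[OF assms(1,2,4), of a] by (simp add: F_def algebra_simps)
    then have "(\<Sum>x\<in>?N. int (card {k \<in> {1..r}. s k mod n = ?c x mod n}))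
      = (\<Sum>p\<in>?U. F (snd p)) - (\<Sum>p\<in>?Z. F (snd p))"
      using tel[of F] by simp
    then show ?thesis
      by (simp add: F_def uz_def zz_def sum_subtractf sum_distrib_left)
  qed
  have inner: "(\<Sum>x\<in>?N. of_bool (?c x mod n = b mod n) - of_bool ((?c x - 1) mod n = b mod n))
    = runner_count n ?U b - runner_count n ?Z b" for b
    using tel[of "\<lambda>a. of_bool (a mod n = b mod n)"] fin by (simp add: runner_count_sum)
  have "(\<Sum>x\<in>?N. \<Sum>y\<in>?N. cartan_mod n (?c x) (?c y))
    = (\<Sum>x\<in>?N. (\<Sum>p\<in>?U. of_bool (?c x mod n = snd p mod n) - of_bool ((?c x - 1) mod n = snd p mod n))
        - (\<Sum>p\<in>?Z. of_bool (?c x mod n = snd p mod n) - of_bool ((?c x - 1) mod n = snd p mod n)))"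
  proof (rule sum.cong[OF refl])
    fix x
    \<comment> \<open>A first difference in the first node; its difference in \<open>b\<close> is
      \<open>cartan_mod\<close>, so the sum over \<open>y\<close> telescopes.\<close>
    define F where "F b = of_bool (?c x mod n = b mod n) - (of_bool ((?c x - 1) mod n = b mod n) :: int)" for b
    have "cartan_mod n (?c x) b = F b - F (b - 1)" for b
      using mod_eq_shift[of "?c x" n "b - 1"]
      by (simp add: cartan_mod_def F_def mod_eq_shift)
    then show "(\<Sum>y\<in>?N. cartan_mod n (?c x) (?c y))
      = (\<Sum>p\<in>?U. of_bool (?c x mod n = snd p mod n) - of_bool ((?c x - 1) mod n = snd p mod n))
        - (\<Sum>p\<in>?Z. of_bool (?c x mod n = snd p mod n) - of_bool ((?c x - 1) mod n = snd p mod n))"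
      using tel[of F] by (simp add: F_def)
  qed
  \<comment> \<open>After exchanging the sums, the remaining sum over \<open>x\<close> telescopes by
    \<open>inner\<close>.\<close>
  also have "\<dots> = (\<Sum>p\<in>?U. runner_count n ?U (snd p) - runner_count n ?Z (snd p))
      - (\<Sum>p\<in>?Z. runner_count n ?U (snd p) - runner_count n ?Z (snd p))"
    by (subst sum_subtractf, subst (1 2) sum.swap) (simp only: inner)
  also have "\<dots> = uu - 2 * uz + zz"
    using zu by (simp add: sum_subtractf uu_def uz_def zz_def)
  \<comment> \<open>In twice \<open>linear\<close> minus \<open>uu - 2 * uz + zz\<close> the mixed
    term \<open>uz\<close> cancels, and \<open>sum_rows_above\<close> removes the row terms.\<close>
  finally show ?thesis
    using pot[OF fin(1)] pot[OF fin(2)] linear sum_rows_above[OF assms(3,4), of "\<lambda>k. int r + 1 - 2 * int k"]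
    unfolding uu_def zz_def by linarith
qed


section \<open>Counting the operations\<close>

lemma beads_shift: "y \<in> beads (a + b) p \<longleftrightarrow> y - b \<in> beads a p"
  by (auto simp: beads_def algebra_simps)

lemma deep_beads:
  assumes "deep_level r s lam L" "k \<in> {1..r}" "y < L"
  shows "y \<in> beads (s k) (lam k)"
proof -
  have "L \<le> s k" "\<And>j. 1 \<le> j \<Longrightarrow> s k - int j < L \<Longrightarrow> lam k j = 0"
    using assms(1,2) by (auto simp: deep_level_def)
  then show ?thesis
    \<comment> \<open>Column \<open>y\<close> is the bead of the zero part with index
      \<open>s k - y\<close>.\<close>
    using assms(3) unfolding beads_def by (auto intro!: exI[of _ "nat (s k - y)"])
qed

lemma deep_full_below: "deep_level r s lam L \<Longrightarrow> full_below r L (abacus r s lam)"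
  by (auto simp: full_below_def abacus_def intro: deep_beads)

text \<open>The inequalities of the closed alcove say that the half-lines \<open>{..<s k}\<close>
  increase with \<open>k\<close> and that the last one, moved left by \<open>n\<close>, fits into
  the first: the vacuum is complete.\<close>

lemma potential_vacuum:
  assumes "0 < n" "s \<in> alcove_closure (enat n) r" "deep_level r s lam (int n * m)" "1 \<le> r"
  shows "potential (int n) r (beads_above (int n * m) (vacuum r s))
    = (2 * m - 1) * int r * int (card (beads_above (int n * m) (vacuum r s)))"
proof (rule potential_complete[where X = "\<lambda>k. {..<s k}", OF _ refl])
  show "{..<s k} \<subseteq> {..<s l}" if "1 \<le> k" "k \<le> l" "l \<le> r" for k l
    using assms(2) that by (cases "k = l") (auto simp: alcove_closure_def)
  show "y - int n \<in> {..<s 1}" if "y \<in> {..<s r}" for y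
  proof -
    have "s r - s 1 \<le> int n"
      using assms(2,4) by (cases "r = 1") (auto simp: alcove_closure_def)
    then show ?thesis using that by auto
  qed
  show "finite (beads_above (int n * m) (vacuum r s))"
    by (rule sum_vacuum_above(1)[OF assms(3)])
qed (use assms(1) in \<open>auto simp: beads_above_def vacuum_def\<close>)

lemma potential_complete_pair:
  assumes "0 < n" "complete_pair (enat n) r t mu" "finite (beads_above (int n * m) (abacus r t mu))"
  shows "potential (int n) r (beads_above (int n * m) (abacus r t mu))
    = (2 * m - 1) * int r * int (card (beads_above (int n * m) (abacus r t mu)))"
proof (rule potential_complete[where X = "\<lambda>k. beads (t k) (mu k)", OF _ refl _ assms(3)])
  show "beads (t k) (mu k) \<subseteq> beads (t l) (mu l)" if "1 \<le> k" "k \<le> l" "l \<le> r" for k l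
    using that(2,3)
  proof (induction rule: dec_induct)
    case (step i)
    then have "1 \<le> i" "i < r" using that(1) by auto
    then have "beads (t i) (mu i) \<subseteq> beads (t (Suc i)) (mu (Suc i))"
      using assms(2) by (simp add: complete_pair_def)
    then show ?case using step by simp
  qed simp
  show "y - int n \<in> beads (t 1) (mu 1)" if "y \<in> beads (t r) (mu r)" for y
    using assms(2) that unfolding complete_pair_def beads_shift[symmetric] by blast
qed (use assms(1) in \<open>auto simp: beads_above_def abacus_def\<close>)

text \<open>The core and the vacuum are complete and have equally many beads from \<open>L\<close>
  on, hence equal potential. The fall of 2 per operation therefore accounts for the whole difference
  between \<open>lam\<close> and the vacuum.\<close>

lemma length_ops_nodes:
  assumes "0 < n" "1 \<le> r" "s \<in> alcove_closure (enat n) r"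
    and "multipartition r lam" "complete_pair (enat n) r t mu"
    and ops: "elementary_ops (enat n) r xs (abacus r s lam) (abacus r t mu)"
  shows "2 * int (length xs)
    = 2 * (\<Sum>x\<in>nodes r lam. int (card {k \<in> {1..r}. s k mod int n = node_content s x mod int n}))
      - (\<Sum>x\<in>nodes r lam. \<Sum>y\<in>nodes r lam. cartan_mod (int n) (node_content s x) (node_content s y))"
    and "set xs \<subseteq> {1..r}"
proof -
  obtain L0 where L0: "\<And>L. L \<le> L0 \<Longrightarrow> deep_level r s lam L"
    using deep_level_exists[OF assms(4)] by blast
  \<comment> \<open>This makes \<open>L\<close> the largest multiple of \<open>n\<close> not above
    \<open>L0\<close>.\<close>
  define m where "m = L0 div int n"
  define L where "L = int n * m"
  have "L \<le> L0"
    using assms(1) by (simp add: L_def m_def mult.commute div_times_less_eq_dividend minus_mod_eq_mult_div[symmetric])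
  then have deep: "deep_level r s lam L" by (rule L0)
  let ?U = "beads_above L (abacus r s lam)" and ?Z = "beads_above L (vacuum r s)"
  let ?C = "beads_above L (abacus r t mu)"
  note * = elementary_ops_potential[OF ops assms(2,1) deep_full_below[OF deep] sum_beads_above(1)[OF assms(4) deep]]
  show "set xs \<subseteq> {1..r}" using * by simp
  have "card ?U = card ?Z"
    using sum_rows_above[OF assms(4) deep, of "\<lambda>_. 1 :: nat"] by simp
  then have "potential (int n) r ?C = potential (int n) r ?Z"
    using potential_complete_pair[OF assms(1,5), of m] potential_vacuum[OF assms(1,3), of lam m] * deep assms(2)
    by (simp add: L_def)
  then have "2 * int (length xs) = potential (int n) r ?U - potential (int n) r ?Z"
    using * by simp
  then show "2 * int (length xs)
    = 2 * (\<Sum>x\<in>nodes r lam. int (card {k \<in> {1..r}. s k mod int n = node_content s x mod int n}))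
      - (\<Sum>x\<in>nodes r lam. \<Sum>y\<in>nodes r lam. cartan_mod (int n) (node_content s x) (node_content s y))"
    using potential_diff_nodes[OF _ _ assms(4) deep, of "int n"] assms(1) by (simp add: L_def)
qed

section \<open>The block weight as sums over nodes\<close>

lemma sum_fibre_cards:
  fixes f :: "'b \<Rightarrow> int"
  assumes "finite N"
  shows "(\<Sum>i | card {x \<in> N. g x = i} \<noteq> 0. int (card {x \<in> N. g x = i}) * f i) = (\<Sum>x\<in>N. f (g x))"
proof -
  have "{i. card {x \<in> N. g x = i} \<noteq> 0} = g ` N"
    using assms by auto
  moreover have "(\<Sum>x\<in>{x \<in> N. g x = i}. f (g x)) = int (card {x \<in> N. g x = i}) * f i" for i
    by simp
  ultimately show ?thesis
    using sum.image_gen[OF assms, of "\<lambda>x. f (g x)" g] by simp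
qed

text \<open>A content coefficient is the size of a fibre of the residue map, so a sum over residues
  weighted by it is a sum over nodes; the root form needs this in both arguments.\<close>

lemma block_weight_nodes:
  assumes "finite (nodes r lam)"
  shows "block_weight e (dominant_weight e r s) (content e r s lam)
    = of_int (\<Sum>x\<in>nodes r lam. int (card {k \<in> {1..r}. residue e (s k) = node_residue e s x}))
      - 1 / 2 * of_int (\<Sum>x\<in>nodes r lam. \<Sum>y\<in>nodes r lam.
          cartan e (node_residue e s x) (node_residue e s y))"
proof -
  let ?res = "node_residue e s" and ?N = "nodes r lam"
  note fib = sum_fibre_cards[OF assms, of ?res, folded content_def]
  have "root_form e (content e r s lam) (content e r s lam)
    = (\<Sum>i | content e r s lam i \<noteq> 0. int (content e r s lam i) *
        (\<Sum>j | content e r s lam j \<noteq> 0. int (content e r s lam j) * cartan e i j))"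
    by (simp add: root_form_def sum_distrib_left mult.assoc)
  also have "\<dots> = (\<Sum>x\<in>?N. \<Sum>y\<in>?N. cartan e (?res x) (?res y))"
    by (simp only: fib)
  finally show ?thesis
    using fib[of "\<lambda>i. int (dominant_weight e r s i)"]
    by (simp add: block_weight_def weight_root_form_def dominant_weight_def mult.commute)
qed

lemma node_residue_content: "node_residue e s x = residue e (node_content s x)"
  by (auto simp: node_residue_def node_content_def split: prod.splits)

text \<open>For \<open>n > 2\<close> the residues of \<open>b - 1\<close>, \<open>b\<close>,
  \<open>b + 1\<close> are distinct, so at most one indicator in \<open>cartan_mod\<close> is
  nonzero. For \<open>n = 2\<close> only parity matters.\<close>

lemma cartan_residue:
  assumes "2 \<le> n"
  shows "cartan (enat n) (residue (enat n) a) (residue (enat n) b) = cartan_mod (int n) a b"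
proof (cases "n = 2")
  case True
  then show ?thesis
    by (auto simp: cartan_def cartan_mod_def residue_def numeral_eq_enat) presburger+
next
  case False
  have ne: "(b + 1) mod int n \<noteq> b mod int n" "(b - 1) mod int n \<noteq> b mod int n"
    "(b + 1) mod int n \<noteq> (b - 1) mod int n"
    using assms False by (auto simp: mod_eq_dvd_iff dest!: zdvd_imp_le)
  then show ?thesis
    using False by (auto simp: cartan_def cartan_mod_def residue_def numeral_eq_enat mod_simps)
qed

section \<open>Replacing infinite \<open>e\<close> by a large finite \<open>n\<close>\<close>

lemma mod_eq_iff_close:
  fixes a b n :: int
  assumes "\<bar>a - b\<bar> < n"
  shows "a mod n = b mod n \<longleftrightarrow> a = b"
  using assms dvd_imp_le_int[of "a - b" n] by (auto simp: mod_eq_dvd_iff)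

text \<open>The margin keeps \<open>a\<close> at distance less than \<open>n\<close> from
  \<open>b\<close>, \<open>b + 1\<close> and \<open>b - 1\<close>, where congruence is
  equality.\<close>

lemma cartan_infinity:
  assumes "\<bar>a - b\<bar> + 3 \<le> n"
  shows "cartan \<infinity> a b = cartan_mod n a b"
proof -
  show ?thesis
    using assms mod_eq_iff_close[of a b n] mod_eq_iff_close[of a "b + 1" n] mod_eq_iff_close[of a "b - 1" n]
    by (auto simp: cartan_def cartan_mod_def residue_def)
qed

text \<open>For infinite \<open>e\<close> only operations of the first kind occur, and these are
  allowed for every \<open>e\<close>.\<close>

lemma elementary_ops_infinity: "elementary_ops \<infinity> r xs A B \<Longrightarrow> elementary_ops e r xs A B"
proof (induction rule: elementary_ops.induct)
  case (one_more_op x A B xs C)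
  have "elementary_op e r x A B"
    using one_more_op.hyps(1) by cases (use elementary_op.first_kind[of x r] in auto)
  then show ?case using one_more_op.IH by (rule elementary_ops.one_more_op)
qed (rule no_op)

theorem lemma4p1p15:
  fixes e :: enat and r :: nat and s :: "nat \<Rightarrow> int"
    and \<beta> :: "int \<Rightarrow> nat" and m :: "nat \<Rightarrow> nat"
  assumes "2 \<le> e" and "1 \<le> r"
    and "s \<in> alcove_closure e r"
    and "is_block e r s \<beta>"
    and "is_block_moving_vector e r s \<beta> m"
  shows "of_nat (\<Sum>i = 1..r. m i) = block_weight e (dominant_weight e r s) \<beta>"
proof -
  obtain lam mu t xs where lam: "multipartition r lam" "\<beta> = content e r s lam"
    and mu: "multipartition r mu" "complete_pair e r t mu"
    and ops: "elementary_ops e r xs (abacus r s lam) (abacus r t mu)"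
    and m: "\<And>i. i \<in> {1..r} \<Longrightarrow> m i = count_list xs i"
    using assms(5) by (auto simp: is_block_moving_vector_def in_block_def is_core_def is_moving_vector_def)
  let ?N = "nodes r lam"
  obtain L where "deep_level r s lam L" using deep_level_exists[OF lam(1)] by blast
  then have fin: "finite ?N" by (rule sum_nodes_telescope(1)[OF lam(1)])
  \<comment> \<open>A finite \<open>n\<close> that gives the same Cartan numbers and residue
    coincidences as \<open>e\<close> on the data at hand; for finite \<open>e\<close> it is
    \<open>e\<close> itself.\<close>
  obtain n where n: "0 < n" "s \<in> alcove_closure (enat n) r" "complete_pair (enat n) r t mu"
      "elementary_ops (enat n) r xs (abacus r s lam) (abacus r t mu)"
    and cart: "\<And>x y. x \<in> ?N \<Longrightarrow> y \<in> ?N \<Longrightarrow>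
      cartan e (node_residue e s x) (node_residue e s y) = cartan_mod (int n) (node_content s x) (node_content s y)"
    and res: "\<And>x k. x \<in> ?N \<Longrightarrow> k \<in> {1..r} \<Longrightarrow>
      residue e (s k) = node_residue e s x \<longleftrightarrow> s k mod int n = node_content s x mod int n"
  proof (cases e)
    case (enat n)
    show ?thesis
    proof (rule that[of n])
      show "0 < n" using assms(1) enat by (simp add: numeral_eq_enat)
      show "cartan e (node_residue e s x) (node_residue e s y) = cartan_mod (int n) (node_content s x) (node_content s y)" for x y
        using cartan_residue[of n] assms(1) enat by (simp add: numeral_eq_enat node_residue_content)
    qed (use enat assms mu ops in \<open>auto simp: node_residue_content residue_def\<close>)
  next
    case infinity
    let ?V = "s ` {1..r} \<union> node_content s ` ?N"
    have "finite ((\<lambda>v. \<bar>v\<bar>) ` ?V)" using fin by simp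
    then obtain M where M: "\<And>v. v \<in> ?V \<Longrightarrow> \<bar>v\<bar> \<le> M"
      by (meson bdd_above.unfold bdd_above_finite imageI)
    obtain L where L: "deep_level r t mu L" using deep_level_exists[OF mu(1)] by blast
    \<comment> \<open>Multicharge entries and contents differ by at most \<open>2 * M\<close>, and 3
      is the margin of \<open>cartan_infinity\<close>. The other bound moves the rightmost bead of
      row \<open>r\<close> of the core to the left of \<open>L\<close>, where row 1 is full.\<close>
    define n where "n = nat (max (2 * M + 3) (max 1 (int (mu r 1) + t r - L + 1)))"
    have n: "2 * M + 3 \<le> int n" "0 < n" "int (mu r 1) + t r - L < int n"
      by (auto simp: n_def)
    show ?thesis
    proof (rule that[of n])
      have "s j - s i \<le> int n" if "i \<in> {1..r}" "j \<in> {1..r}" for i j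
        using M[of "s i"] M[of "s j"] that n(1) by auto
      then show "s \<in> alcove_closure (enat n) r"
        using assms(3) by (auto simp: alcove_closure_def)
      \<comment> \<open>Completeness for infinite \<open>e\<close> has no wrap-around inclusion; the
        size of \<open>n\<close> supplies it.\<close>
      have "y \<in> beads (t 1 + int n) (mu 1)" if y: "y \<in> beads (t r) (mu r)" for y
      proof -
        obtain j where j: "1 \<le> j" "y = int (mu r j) - int j + t r" using y by (auto simp: beads_def)
        have "mu r j \<le> mu r 1"
          using mu(1) assms(2) j(1) by (auto simp: multipartition_def partition_def)
        then have "y - int n < L" using j n(3) by linarith
        then show ?thesis using deep_beads[OF L, of 1] assms(2) by (simp add: beads_shift)
      qed
      then show "complete_pair (enat n) r t mu"
        using mu(2) by (auto simp: complete_pair_def)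
      show "elementary_ops (enat n) r xs (abacus r s lam) (abacus r t mu)"
        using ops infinity by (auto intro: elementary_ops_infinity)
      show "cartan e (node_residue e s x) (node_residue e s y) = cartan_mod (int n) (node_content s x) (node_content s y)"
        if "x \<in> ?N" "y \<in> ?N" for x y
      proof -
        have "\<bar>node_content s x\<bar> \<le> M" "\<bar>node_content s y\<bar> \<le> M" using M that by auto
        then show ?thesis
          using cartan_infinity[of "node_content s x" "node_content s y" "int n"] n(1) infinity
          by (simp add: node_residue_content residue_def)
      qed
      show "residue e (s k) = node_residue e s x \<longleftrightarrow> s k mod int n = node_content s x mod int n"
        if "x \<in> ?N" "k \<in> {1..r}" for x k
      proof -
        have "\<bar>s k\<bar> \<le> M" "\<bar>node_content s x\<bar> \<le> M" using M that by auto
        then show ?thesis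
          using n(1) infinity mod_eq_iff_close[of "s k" "node_content s x" "int n"]
          by (auto simp: node_residue_content residue_def)
      qed
    qed (use n in simp)
  qed
  note len = length_ops_nodes[OF n(1) assms(2) n(2) lam(1) n(3,4)]
  \<comment> \<open>Every operation moves a bead out of one of the rows \<open>1..r\<close>, so the
    row counts add up to the number of operations.\<close>
  have "(\<Sum>i = 1..r. m i) = (\<Sum>i = 1..r. count_list xs i)"
    using m by simp
  also have "\<dots> = length xs"
    using len(2) by (simp add: sum_count_set)
  finally have "(\<Sum>i = 1..r. m i) = length xs" .
  moreover have "(\<Sum>x\<in>?N. \<Sum>y\<in>?N. cartan e (node_residue e s x) (node_residue e s y))
    = (\<Sum>x\<in>?N. \<Sum>y\<in>?N. cartan_mod (int n) (node_content s x) (node_content s y))"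
    by (intro sum.cong refl cart)
  moreover have "(\<Sum>x\<in>?N. int (card {k \<in> {1..r}. residue e (s k) = node_residue e s x}))
    = (\<Sum>x\<in>?N. int (card {k \<in> {1..r}. s k mod int n = node_content s x mod int n}))"
    using res by (intro sum.cong refl arg_cong[where f = "\<lambda>A. int (card A)"]) auto
  moreover have "rat_of_nat (length xs) = of_int (2 * int (length xs)) / 2" by simp
  ultimately show ?thesis
    unfolding lam(2) block_weight_nodes[OF fin] by (simp only: len(1)) (simp add: diff_divide_distrib)
qed

end
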